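(* Let $n\in\mathbb{N}$. The symmetric group $\mathcal{S}_n$ satisfies the RCC; that is, every automorphism $\alpha$ of $\mathcal{S}_n$, viewed as a permutation of the underlying set of $\mathcal{S}_n$, has a cycle whose length equals $\mathrm{ord}(\alpha)$.
   Context: $\mathbb{N}$ denotes the natural numbers including $0$, and $\mathcal{S}_n$ is the symmetric group on $n$ points. A permutation of a finite set satisfies the regular cycle condition (RCC) if it has a cycle whose length equals its order. A finite group satisfies the RCC if every automorphism of it, viewed as a permutation of its underlying set, satisfies the RCC. *)

theory Defs
  imports
    "HOL-Algebra.Sym_Groups"
    "HOL-Algebra.Multiplicative_Group"
    "HOL-Algebra.Bij"
    "HOL-Combinatorics.Orbits"
begin

text \<open>
  A permutation of \<open>X\<close> is an element of \<^term>\<open>Bij X\<close>, the carrier of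
  \<^term>\<open>BijGroup X\<close>. The cycle of \<open>f\<close> through \<open>x\<close> is represented by
  the set \<^term>\<open>Orbits.orbit f x\<close> of its points, and its length is the number of
  these points (so fixed points are cycles of length 1). Finiteness of \<open>X\<close> is part of
  the notion; without it, an infinite cycle of a permutation of infinite order would
  count, as \<open>card\<close> and \<open>ord\<close> are then both 0.
\<close>

definition perm_RCC :: "'a set \<Rightarrow> ('a \<Rightarrow> 'a) \<Rightarrow> bool" where
  "perm_RCC X f \<longleftrightarrow> finite X \<and> f \<in> Bij X \<and>
     (\<exists>x\<in>X. card (Orbits.orbit f x) = group.ord (BijGroup X) f)"

definition group_RCC :: "('a, 'b) monoid_scheme \<Rightarrow> bool" where
  "group_RCC G \<longleftrightarrow> group G \<and> finite (carrier G) \<and>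
     (\<forall>\<alpha>\<in>auto G. perm_RCC (carrier G) \<alpha>)"

end

theory Submission
  imports Defs
begin

text \<open>
  A point \<open>g\<close> lies on a regular cycle of \<open>\<alpha>\<close> as soon as every power of \<open>\<alpha>\<close> fixing \<open>g\<close> is
  trivial. If \<open>\<alpha>\<close> maps transpositions to transpositions, it is conjugation by some \<open>\<sigma>\<close>, and
  an \<open>(n - 1)\<close>-cycle whose fixed point is moved by \<open>\<sigma>\<close> does the job. Otherwise \<open>n = 6\<close>,
  because a product of two transpositions has order at most 3 and the image class violates this
  in all other degrees (degree 4 is excluded by parity). In degree 6, \<open>\<alpha>\<close> exchanges
  transpositions with fixed-point-free involutions, so no odd power of \<open>\<alpha>\<close> fixes a
  transposition, while \<open>\<alpha>\<^sup>2\<close> is conjugation by some \<open>\<sigma>\<close>. It then suffices to find \<open>g\<close> having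
  a transposition among its powers and no nontrivial power of \<open>\<sigma>\<close> in its centralizer: if
  \<open>\<sigma>\<^sup>2 \<noteq> 1\<close>, a suitable \<open>g\<close> of cycle type \<open>(3, 2, 1)\<close>, and otherwise a transposition.
\<close>

section \<open>Permutations with prescribed values, and transpositions\<close>

abbreviation swp :: "'a \<Rightarrow> 'a \<Rightarrow> 'a \<Rightarrow> 'a" where
  "swp \<equiv> Transposition.transpose"

text \<open>Induction on the lists: composing with the transposition of \<open>\<pi> x\<close> and
  \<open>y\<close> corrects the value at \<open>x\<close> and leaves the values at the other entries
  alone. The explicit permutations with prescribed values below come from here.\<close>

lemma permutes_map_lists:
  assumes "distinct xs" "distinct ys" "length xs = length ys" "set xs \<subseteq> S" "set ys \<subseteq> S"
  shows "\<exists>\<pi>. \<pi> permutes S \<and> map \<pi> xs = ys"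
  using assms(3,1,2,4,5)
proof (induction xs ys rule: list_induct2)
  case Nil
  have "map id [] = []" by simp
  with permutes_id[of S] show ?case by metis
next
  case (Cons x xs y ys)
  then obtain \<pi> where \<pi>: "\<pi> permutes S" "map \<pi> xs = ys" by auto
  have inj: "inj \<pi>" using \<pi>(1) by (rule permutes_inj)
  have "\<pi> z \<noteq> \<pi> x \<and> \<pi> z \<noteq> y" if "z \<in> set xs" for z
    using that \<pi>(2) Cons.prems(1,2) inj by (auto simp: inj_eq)
  then have "map (swp (\<pi> x) y \<circ> \<pi>) xs = ys"
    using \<pi>(2) by (auto intro!: map_cong)
  then have "map (swp (\<pi> x) y \<circ> \<pi>) (x # xs) = y # ys" by simp
  moreover have "swp (\<pi> x) y \<circ> \<pi> permutes S"
    using \<pi>(1) Cons.prems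
    by (intro permutes_compose permutes_swap_id) (auto simp: permutes_in_image)
  ultimately show ?case by (intro exI[of _ "swp (\<pi> x) y \<circ> \<pi>"] conjI)
qed

lemma inj_comp_transpose:
  assumes "inj \<pi>"
  shows "\<pi> \<circ> swp a b = swp (\<pi> a) (\<pi> b) \<circ> \<pi>"
  using assms by (auto simp: fun_eq_iff transpose_def inj_eq)

text \<open>Disjoint transpositions commute, so their product squares to the identity;
  transpositions sharing exactly one point multiply to a 3-cycle. Automorphisms carry this bound
  over to the images of transpositions.\<close>

lemma transpose_comp_order:
  assumes "p = swp a b" "q = swp c d"
  shows "(p \<circ> q) ^^ 2 = id \<or> (p \<circ> q) ^^ 3 = id"
proof -
  have comm: "(p \<circ> q) ^^ 2 = id" if "p \<circ> q = q \<circ> p"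
  proof -
    have "(p \<circ> q) ^^ 2 = (p \<circ> q) \<circ> (q \<circ> p)"
      using that by (simp add: numeral_2_eq_2)
    also have "\<dots> = id" using assms by (auto simp: fun_eq_iff)
    finally show ?thesis .
  qed
  consider "{a, b} \<inter> {c, d} = {}" | "a = c" | "a = d" | "b = c" | "b = d" by auto
  then show ?thesis
  proof cases
    case 1
    then have "p \<circ> q = q \<circ> p" using assms by (auto simp: fun_eq_iff transpose_def)
    then show ?thesis using comm by simp
  qed (use assms in \<open>auto simp: fun_eq_iff transpose_def numeral_2_eq_2 numeral_3_eq_3\<close>)
qed

text \<open>Disjoint or equal transpositions commute, so the supports meet in exactly one point,
  which becomes \<open>x\<close>.\<close>

lemma noncommuting_transposes_share_point:
  assumes "swp a b \<circ> swp c d \<noteq> swp c d \<circ> swp a b"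
  shows "\<exists>x y z. distinct [x, y, z] \<and> {x, y, z} \<subseteq> {a, b, c, d} \<and>
    swp a b = swp x y \<and> swp c d = swp x z"
proof -
  have neq: "a \<noteq> b" "c \<noteq> d" using assms by auto
  have "{a, b} \<inter> {c, d} \<noteq> {}" using assms by (auto simp: fun_eq_iff transpose_def split: if_splits)
  moreover have "{a, b} \<noteq> {c, d}" using assms by (auto simp: doubleton_eq_iff transpose_commute)
  ultimately consider "a = c" "b \<noteq> d" | "a = d" "b \<noteq> c" | "b = c" "a \<noteq> d" | "b = d" "a \<noteq> c"
    by auto
  then show ?thesis
  proof cases
    case 1 then show ?thesis using neq by (intro exI[of _ a] exI[of _ b] exI[of _ d]) auto
  next
    case 2 then show ?thesis using neq
      by (intro exI[of _ a] exI[of _ b] exI[of _ c]) (auto simp: transpose_commute)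
  next
    case 3 then show ?thesis using neq
      by (intro exI[of _ b] exI[of _ a] exI[of _ d]) (auto simp: transpose_commute)
  next
    case 4 then show ?thesis using neq
      by (intro exI[of _ b] exI[of _ a] exI[of _ c]) (auto simp: transpose_commute)
  qed
qed

text \<open>The condition \<open>a \<noteq> b\<close> excludes the identity, which is
  \<open>swp a a\<close>.\<close>

definition is_swap :: "'a set \<Rightarrow> ('a \<Rightarrow> 'a) \<Rightarrow> bool" where
  "is_swap S p \<longleftrightarrow> (\<exists>a\<in>S. \<exists>b\<in>S. a \<noteq> b \<and> p = swp a b)"

lemma is_swapI: "a \<in> S \<Longrightarrow> b \<in> S \<Longrightarrow> a \<noteq> b \<Longrightarrow> is_swap S (swp a b)"
  by (auto simp: is_swap_def)

lemma is_swap_permutes: "is_swap S p \<Longrightarrow> p permutes S"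
  by (auto simp: is_swap_def permutes_swap_id)

lemma is_swap_conj:
  assumes "is_swap S p" "\<pi> permutes S"
  shows "is_swap S (\<pi> \<circ> p \<circ> inv' \<pi>)"
proof -
  obtain a b where ab: "a \<in> S" "b \<in> S" "a \<noteq> b" "p = swp a b"
    using assms(1) by (auto simp: is_swap_def)
  have "\<pi> \<circ> p \<circ> inv' \<pi> = swp (\<pi> a) (\<pi> b) \<circ> (\<pi> \<circ> inv' \<pi>)"
    using ab(4) inj_comp_transpose[OF permutes_inj[OF assms(2)]] by (simp add: comp_assoc)
  also have "\<dots> = swp (\<pi> a) (\<pi> b)" using permutes_inv_o(1)[OF assms(2)] by simp
  finally show ?thesis
    using ab assms(2) by (auto intro!: is_swapI simp: permutes_in_image inj_eq[OF permutes_inj])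
qed

lemma is_swap_conjugate:
  assumes "is_swap S p" "is_swap S q"
  shows "\<exists>\<pi>. \<pi> permutes S \<and> \<pi> \<circ> p = q \<circ> \<pi>"
proof -
  obtain a b c d where ab: "a \<in> S" "b \<in> S" "a \<noteq> b" "p = swp a b"
    and cd: "c \<in> S" "d \<in> S" "c \<noteq> d" "q = swp c d"
    using assms by (auto simp: is_swap_def)
  obtain \<pi> where "\<pi> permutes S" "map \<pi> [a, b] = [c, d]"
    using permutes_map_lists[of "[a, b]" "[c, d]" S] ab cd by auto
  then show ?thesis using ab(4) cd(4) inj_comp_transpose[OF permutes_inj] by fastforce
qed

section \<open>Automorphisms given by conjugation\<close>

text \<open>Conjugation by \<open>\<sigma>\<close>, written without an inverse so that iterates of
  \<open>\<alpha>\<close> follow by composing equations.\<close>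

definition inner_on :: "'a set \<Rightarrow> ('a \<Rightarrow> 'a) \<Rightarrow> (('a \<Rightarrow> 'a) \<Rightarrow> 'a \<Rightarrow> 'a) \<Rightarrow> bool" where
  "inner_on S \<sigma> \<alpha> \<longleftrightarrow> \<sigma> permutes S \<and>
     (\<forall>p. p permutes S \<longrightarrow> \<alpha> p permutes S \<and> \<alpha> p \<circ> \<sigma> = \<sigma> \<circ> p)"

lemma inner_on_funpow:
  assumes "inner_on S \<sigma> \<alpha>" "p permutes S"
  shows "(\<alpha> ^^ j) p permutes S \<and> (\<alpha> ^^ j) p \<circ> \<sigma> ^^ j = \<sigma> ^^ j \<circ> p"
proof (induction j)
  case 0
  then show ?case using assms(2) by simp
next
  case (Suc j)
  let ?q = "(\<alpha> ^^ j) p"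
  have "\<alpha> ?q permutes S" "\<alpha> ?q \<circ> \<sigma> = \<sigma> \<circ> ?q" using Suc assms(1) by (auto simp: inner_on_def)
  then show ?case using Suc by (metis comp_assoc funpow.simps(2) o_apply)
qed

text \<open>Witnesses are chosen through their centralizers by this translation: being fixed by a
  power of \<open>\<alpha>\<close> becomes commuting with that power of
  \<open>\<sigma>\<close>.\<close>

lemma inner_on_funpow_fixed:
  assumes "inner_on S \<sigma> \<alpha>" "p permutes S" "(\<alpha> ^^ j) p = p"
  shows "p ((\<sigma> ^^ j) x) = (\<sigma> ^^ j) (p x)"
  using inner_on_funpow[OF assms(1,2), of j] assms(3) by (simp add: fun_eq_iff)

lemma inner_on_funpow_id:
  assumes "inner_on S \<sigma> \<alpha>" "p permutes S" "\<And>x. x \<in> S \<Longrightarrow> (\<sigma> ^^ j) x = x"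
  shows "(\<alpha> ^^ j) p = p"
proof -
  have "\<sigma> permutes S" using assms(1) by (simp add: inner_on_def)
  then have "(\<sigma> ^^ j) permutes S" by (rule permutes_funpow)
  then have "\<sigma> ^^ j = id" using assms(3) by (auto simp: fun_eq_iff permutes_def)
  then show ?thesis using inner_on_funpow[OF assms(1,2), of j] by simp
qed

text \<open>The witness is a cycle through all points but one point \<open>x\<close> moved by \<open>\<sigma>\<close>: a power of
  \<open>\<sigma>\<close> commuting with it fixes \<open>x\<close>, hence \<open>\<sigma> x\<close>, hence the whole cycle.\<close>

lemma inner_regular_point:
  assumes "finite S" "inner_on S \<sigma> \<alpha>" "card S \<ge> 3"
  shows "\<exists>g. g permutes S \<and>
    (\<forall>j. (\<alpha> ^^ j) g = g \<longrightarrow> (\<forall>p. p permutes S \<longrightarrow> (\<alpha> ^^ j) p = p))"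
proof (cases "\<sigma> = id")
  case True
  show ?thesis
  proof (intro exI[of _ id] conjI allI impI)
    show "id permutes S" by (rule permutes_id)
    fix j p assume "p permutes S"
    then show "(\<alpha> ^^ j) p = p" using True by (intro inner_on_funpow_id[OF assms(2)]) simp_all
  qed
next
  case False
  have \<sigma>: "\<sigma> permutes S" using assms(2) by (simp add: inner_on_def)
  obtain x where x: "\<sigma> x \<noteq> x" using False by (auto simp: fun_eq_iff)
  have xS: "x \<in> S" using x \<sigma> by (auto simp: permutes_def)
  have yS: "\<sigma> x \<in> S" using xS \<sigma> by (simp add: permutes_in_image)
  obtain cs' where cs': "set cs' = S - {x, \<sigma> x}" "distinct cs'"
    using finite_distinct_list[of "S - {x, \<sigma> x}"] assms(1) by auto
  \<comment> \<open>Putting \<open>\<sigma> x\<close> first lets the induction along the cycle start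
    at a point already known to be fixed.\<close>
  define cs where "cs = \<sigma> x # cs'"
  have cs: "distinct cs" "set cs = S - {x}" using cs' x yS by (auto simp: cs_def)
  \<comment> \<open>At least two entries, by \<open>card S \<ge> 3\<close>: a cycle of length 1
    would fix its point.\<close>
  have len: "length cs \<ge> 2" using assms(1,3) xS distinct_card[OF cs(1)] cs(2) by simp
  \<comment> \<open>\<open>rotate1\<close> sends each entry to the next, so \<open>g\<close> is the
    cycle along \<open>cs\<close>.\<close>
  obtain g where g: "g permutes set cs" "map g cs = rotate1 cs"
    using permutes_map_lists[of cs "rotate1 cs" "set cs"] cs(1) unfolding set_rotate1 distinct1_rotate
      length_rotate1 by blast
  have gnth: "g (cs ! i) = cs ! (Suc i mod length cs)" if "i < length cs" for i
    using arg_cong[OF g(2), of "\<lambda>l. l ! i"] that by (simp add: nth_rotate1)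
  have g_ne: "g y \<noteq> y" if "y \<in> S" "y \<noteq> x" for y
  proof -
    have "y \<in> set cs" using that cs(2) by simp
    then obtain i where i: "i < length cs" "y = cs ! i" by (auto simp: in_set_conv_nth)
    have "Suc i mod length cs \<noteq> i" using i(1) len by (cases "Suc i = length cs") auto
    moreover have "Suc i mod length cs < length cs" using len by (intro mod_less_divisor) auto
    ultimately show ?thesis using gnth[OF i(1)] i nth_eq_iff_index_eq[OF cs(1)] by simp
  qed
  have gS: "g permutes S" by (rule permutes_subset[OF g(1)]) (use cs(2) in simp)
  have gx: "g x = x" using g(1) cs(2) by (auto simp: permutes_def)
  show ?thesis
  proof (intro exI[of _ g] conjI allI impI gS)
    fix j p assume j: "(\<alpha> ^^ j) g = g" and p: "p permutes S"
    let ?\<tau> = "\<sigma> ^^ j"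
    have comm: "g (?\<tau> y) = ?\<tau> (g y)" for y by (rule inner_on_funpow_fixed[OF assms(2) gS j])
    have \<tau>S: "?\<tau> permutes S" using \<sigma> by (rule permutes_funpow)
    have "g (?\<tau> x) = ?\<tau> x" using comm[of x] gx by simp
    \<comment> \<open>\<open>x\<close> is the only point of \<open>S\<close> fixed by
      \<open>g\<close>.\<close>
    then have \<tau>x: "?\<tau> x = x" using g_ne[of "?\<tau> x"] xS permutes_in_image[OF \<tau>S, of x] by blast
    have "?\<tau> (\<sigma> x) = \<sigma> (?\<tau> x)" by (simp add: funpow_swap1)
    then have \<tau>y: "?\<tau> (\<sigma> x) = \<sigma> x" using \<tau>x by simp
    have "?\<tau> (cs ! i) = cs ! i" if "i < length cs" for i
      using that
    proof (induction i)
      case 0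
      then show ?case using \<tau>y by (simp add: cs_def)
    next
      case (Suc i)
      have "?\<tau> (cs ! Suc i) = ?\<tau> (g (cs ! i))" using gnth[of i] Suc.prems by simp
      also have "\<dots> = g (?\<tau> (cs ! i))" using comm by simp
      also have "\<dots> = cs ! Suc i" using gnth[of i] Suc by simp
      finally show ?case .
    qed
    then have "?\<tau> z = z" if "z \<in> set cs" for z
      using that by (auto simp: in_set_conv_nth)
    then have "?\<tau> z = z" if "z \<in> S" for z
      using that \<tau>x cs(2) by (cases "z = x") simp_all
    then show "(\<alpha> ^^ j) p = p" using inner_on_funpow_id[OF assms(2) p] by simp
  qed
qed

section \<open>Fixed-point-free involutions in degree 6\<close>

text \<open>Pairs \<open>{a, p a}\<close> are split off one at a time: the part already chosen is
  closed under \<open>p\<close>, so a new point brings a new pair, and three pairs exhaust six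
  points.\<close>

lemma fixed_point_free_involution_card_6:
  assumes "p permutes S" "p \<circ> p = id" "\<And>x. x \<in> S \<Longrightarrow> p x \<noteq> x" "card S = 6"
  shows "\<exists>a b c. distinct [a, p a, b, p b, c, p c] \<and> S = {a, p a, b, p b, c, p c}"
proof -
  have pp [simp]: "p (p x) = x" for x using assms(2) by (simp add: fun_eq_iff)
  have pin: "p x \<in> S \<longleftrightarrow> x \<in> S" for x using assms(1) by (simp add: permutes_in_image)
  have fin: "finite S" using assms(4) card.infinite by fastforce
  have "S \<noteq> {}" using assms(4) by auto
  then obtain a where a: "a \<in> S" by auto
  have d2: "distinct [a, p a]" using assms(3)[OF a] by auto
  have "card {a, p a} = 2" using d2 by simp
  then have "S \<noteq> {a, p a}" using assms(4) by auto
  then obtain b where b: "b \<in> S" "b \<notin> {a, p a}" using a pin by blast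
  have "p b \<notin> {a, p a, b}" using b assms(3)[OF b(1)] by auto (metis pp)+
  then have d4: "distinct [a, p a, b, p b]" using d2 b by auto
  have "card {a, p a, b, p b} = 4" using d4 by simp
  then have "S \<noteq> {a, p a, b, p b}" using assms(4) by auto
  then obtain c where c: "c \<in> S" "c \<notin> {a, p a, b, p b}" using a b pin by blast
  have "p c \<notin> {a, p a, b, p b, c}" using c assms(3)[OF c(1)] by auto (metis pp)+
  then have d6: "distinct [a, p a, b, p b, c, p c]" using d4 c by auto
  have "card {a, p a, b, p b, c, p c} = card S" using d6 assms(4) by simp
  moreover have "{a, p a, b, p b, c, p c} \<subseteq> S" using a b c pin by blast
  ultimately have "{a, p a, b, p b, c, p c} = S" using card_subset_eq[OF fin] by blast
  then show ?thesis using d6 by blast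
qed

text \<open>Matching the three pairs of \<open>p\<close> with those of \<open>q\<close> gives the
  conjugating permutation.\<close>

lemma fixed_point_free_involutions_conjugate:
  assumes p: "p permutes S" "p \<circ> p = id" "\<And>x. x \<in> S \<Longrightarrow> p x \<noteq> x"
    and q: "q permutes S" "q \<circ> q = id" "\<And>x. x \<in> S \<Longrightarrow> q x \<noteq> x"
    and "card S = 6"
  shows "\<exists>\<pi>. \<pi> permutes S \<and> \<pi> \<circ> p = q \<circ> \<pi>"
proof -
  obtain a b c where abc: "distinct [a, p a, b, p b, c, p c]" "S = {a, p a, b, p b, c, p c}"
    using fixed_point_free_involution_card_6[OF p assms(7)] by blast
  obtain a' b' c' where abc': "distinct [a', q a', b', q b', c', q c']"
    "S = {a', q a', b', q b', c', q c'}"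
    using fixed_point_free_involution_card_6[OF q assms(7)] by blast
  have "set [a, p a, b, p b, c, p c] \<subseteq> S" using abc(2) by simp
  moreover have "set [a', q a', b', q b', c', q c'] \<subseteq> S" using abc'(2) by simp
  ultimately obtain \<pi> where \<pi>: "\<pi> permutes S"
    "map \<pi> [a, p a, b, p b, c, p c] = [a', q a', b', q b', c', q c']"
    using permutes_map_lists[OF abc(1) abc'(1), of S] by auto
  have pp: "p (p x) = x" and qq: "q (q x) = x" for x
    using p(2) q(2) by (simp_all add: fun_eq_iff)
  have "\<pi> (p x) = q (\<pi> x)" for x
  proof (cases "x \<in> S")
    case True
    then have "x \<in> {a, p a, b, p b, c, p c}" using abc(2) by simp
    then show ?thesis using \<pi>(2) by (auto simp: pp qq)
  next
    case False
    then show ?thesis using \<pi>(1) p(1) q(1) by (simp add: permutes_def)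
  qed
  then show ?thesis using \<pi>(1) by (auto simp: fun_eq_iff)
qed

section \<open>Automorphisms of a symmetric group\<close>

text \<open>Permutations are total functions that are the identity off \<open>S\<close>, and the
  group operation is plain composition. The square \<open>\<alpha> \<circ> \<alpha>\<close> is again
  an instance, so that results proved here apply to it too.\<close>

locale symmetric_auto =
  fixes S :: "'a set" and \<alpha> :: "('a \<Rightarrow> 'a) \<Rightarrow> ('a \<Rightarrow> 'a)"
  assumes finite_S: "finite S"
    and bij: "bij_betw \<alpha> {p. p permutes S} {p. p permutes S}"
    and hom: "p permutes S \<Longrightarrow> q permutes S \<Longrightarrow> \<alpha> (p \<circ> q) = \<alpha> p \<circ> \<alpha> q"
begin

lemma permutes_image: "p permutes S \<Longrightarrow> \<alpha> p permutes S"
  using bij by (auto simp: bij_betw_def)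

lemma eq_iff: "p permutes S \<Longrightarrow> q permutes S \<Longrightarrow> \<alpha> p = \<alpha> q \<longleftrightarrow> p = q"
  using bij by (auto simp: bij_betw_def inj_on_def)

lemma surjE:
  assumes "q permutes S"
  obtains p where "p permutes S" "\<alpha> p = q"
proof -
  have "q \<in> \<alpha> ` {p. p permutes S}" using assms bij_betw_imp_surj_on[OF bij] by simp
  then show thesis using that by (auto elim: imageE)
qed

lemma image_id: "\<alpha> id = id"
proof -
  have "\<alpha> id \<circ> \<alpha> id = \<alpha> id" using hom[OF permutes_id permutes_id] by simp
  moreover have "inj (\<alpha> id)" by (rule permutes_inj[OF permutes_image[OF permutes_id]])
  ultimately show ?thesis by (metis comp_apply eq_id_iff injD)
qed

lemma image_funpow:
  assumes "p permutes S"
  shows "\<alpha> (p ^^ k) = \<alpha> p ^^ k"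
proof (induction k)
  case 0
  show ?case by (simp add: image_id flip: id_def)
next
  case (Suc k)
  then show ?case using hom[OF assms permutes_funpow[OF assms]] by (metis funpow.simps(2))
qed

lemma symmetric_auto_comp: "symmetric_auto S (\<alpha> \<circ> \<alpha>)"
  using finite_S bij_betw_trans[OF bij bij] by unfold_locales (simp_all add: hom permutes_image)

lemma funpow_permutes: "p permutes S \<Longrightarrow> (\<alpha> ^^ j) p permutes S"
  by (induction j) (auto simp: permutes_image)

lemma funpow_image_funpow: "p permutes S \<Longrightarrow> (\<alpha> ^^ j) (p ^^ k) = ((\<alpha> ^^ j) p) ^^ k"
  by (induction j) (auto simp: image_funpow funpow_permutes)

lemma image_conj:
  assumes "p permutes S" "\<pi> permutes S" "\<pi> \<circ> p = q \<circ> \<pi>" "q permutes S"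
  shows "\<alpha> \<pi> \<circ> \<alpha> p \<circ> inv' (\<alpha> \<pi>) = \<alpha> q"
proof -
  have "\<alpha> \<pi> \<circ> \<alpha> p = \<alpha> q \<circ> \<alpha> \<pi>" using assms hom by metis
  then show ?thesis
    using permutes_inv_o(1)[OF permutes_image[OF assms(2)]] by (simp add: comp_assoc)
qed

text \<open>Transpositions form a single conjugacy class, and \<open>\<alpha>\<close> carries
  conjugate elements to conjugate elements.\<close>

lemma is_swap_image_all:
  assumes "is_swap S s" "is_swap S (\<alpha> s)" "is_swap S t"
  shows "is_swap S (\<alpha> t)"
proof -
  obtain \<pi> where \<pi>: "\<pi> permutes S" "\<pi> \<circ> s = t \<circ> \<pi>" using is_swap_conjugate[OF assms(1,3)] by auto
  then have "\<alpha> \<pi> \<circ> \<alpha> s \<circ> inv' (\<alpha> \<pi>) = \<alpha> t"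
    using image_conj assms is_swap_permutes by metis
  then show ?thesis using is_swap_conj[OF assms(2) permutes_image[OF \<pi>(1)]] by simp
qed

section \<open>The possible images of a transposition\<close>

text \<open>By surjectivity \<open>\<pi>\<close> is an image, so \<open>q\<close> is the image of a
  conjugate \<open>t\<close> of \<open>s\<close>, again a transposition;
  \<open>\<alpha> s \<circ> q\<close> is then the image of \<open>s \<circ> t\<close>.\<close>

lemma swap_image_comp_order:
  assumes s: "is_swap S s" and \<pi>: "\<pi> permutes S"
    and q: "q = \<pi> \<circ> \<alpha> s \<circ> inv' \<pi>"
  shows "(\<alpha> s \<circ> q) ^^ 2 = id \<or> (\<alpha> s \<circ> q) ^^ 3 = id"
proof -
  obtain u where u: "u permutes S" "\<alpha> u = \<pi>" using surjE[OF \<pi>] .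
  define t where "t = u \<circ> s \<circ> inv' u"
  have t: "is_swap S t" using is_swap_conj[OF s u(1)] by (simp add: t_def)
  have "u \<circ> s = t \<circ> u" using permutes_inv_o(2)[OF u(1)] by (simp add: t_def comp_assoc)
  then have "\<alpha> t = q" using image_conj u s t q is_swap_permutes by metis
  then have "\<alpha> s \<circ> q = \<alpha> (s \<circ> t)" using hom s t is_swap_permutes by metis
  moreover have "s \<circ> t permutes S" using s t is_swap_permutes permutes_compose by metis
  moreover have "(s \<circ> t) ^^ 2 = id \<or> (s \<circ> t) ^^ 3 = id"
    using s t transpose_comp_order unfolding is_swap_def by metis
  ultimately show ?thesis using image_funpow image_id by metis
qed

text \<open>\<open>p = \<alpha> s\<close> is an involution with at least two 2-cycles. If it had a
  fixed point in \<open>S\<close>, or at least four 2-cycles, some conjugate \<open>q\<close> would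
  make \<open>p \<circ> q\<close> violate the order bound. Otherwise only two or three 2-cycles
  remain, and two are excluded by parity.\<close>

lemma swap_image_exceptional:
  assumes s: "is_swap S s" and ns: "\<not> is_swap S (\<alpha> s)"
  shows "card S = 6 \<and> (\<forall>x\<in>S. \<alpha> s x \<noteq> x)"
proof -
  define p where "p = \<alpha> s"
  have sS: "s permutes S" using s by (rule is_swap_permutes)
  have pS: "p permutes S" using permutes_image[OF sS] by (simp add: p_def)
  have "s \<circ> s = id" using s by (auto simp: is_swap_def)
  then have "p \<circ> p = id" using hom[OF sS sS] image_id by (simp add: p_def)
  then have pp [simp]: "p (p x) = x" for x by (simp add: fun_eq_iff)
  have injp: "p x = p y \<longleftrightarrow> x = y" for x y by (metis pp)
  have pin: "p x \<in> S \<longleftrightarrow> x \<in> S" for x using pS by (simp add: permutes_in_image)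
  have "s \<noteq> id" using s by (auto simp: is_swap_def transpose_eq_id_iff)
  then have "p \<noteq> id" using eq_iff[OF sS permutes_id] image_id by (simp add: p_def)
  then obtain a where a: "p a \<noteq> a" by (auto simp: fun_eq_iff)
  have aS: "a \<in> S" using a pS by (auto simp: permutes_def)
  define b where "b = p a"
  have "p \<noteq> swp a b" using ns aS a pin is_swapI[of a S b] by (auto simp: p_def b_def)
  then obtain c where "p c \<noteq> swp a b c" by (auto simp: fun_eq_iff)
  then have c: "p c \<noteq> c" "c \<noteq> a" "c \<noteq> b" by (auto simp: b_def transpose_def split: if_splits)
  have cS: "c \<in> S" using c(1) pS by (auto simp: permutes_def)
  define d where "d = p c"
  have pv: "p a = b" "p b = a" "p c = d" "p d = c" by (simp_all add: b_def d_def)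
  have dist: "distinct [a, b, c, d]" using a c pv by (auto simp: injp)
  have inS: "a \<in> S" "b \<in> S" "c \<in> S" "d \<in> S" using aS cS pin by (auto simp: b_def d_def)
  \<comment> \<open>Following the single point \<open>a\<close> suffices to refute both possible
    exponents.\<close>
  have order: "\<not> (((p \<circ> q) ^^ 2) a \<noteq> a \<and> ((p \<circ> q) ^^ 3) a \<noteq> a)"
    if "\<pi> permutes S" "q = \<pi> \<circ> p \<circ> inv' \<pi>" for \<pi> q
    using swap_image_comp_order[OF s that(1)] that(2) by (auto simp: p_def)
  have conj: "(\<pi> \<circ> p \<circ> inv' \<pi>) (\<pi> x) = \<pi> (p x)" if "\<pi> permutes S" for \<pi> x
    using permutes_inverses(2)[OF that] by simp
  have fpf: "p e \<noteq> e" if e: "e \<in> S" for e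
  proof
    assume pe: "p e = e"
    have "e \<notin> {a, b, c, d}" using pe dist pv by auto
    \<comment> \<open>Shifting the five points makes \<open>p \<circ> q\<close> a 5-cycle on them; below, shifting eight points gives
      two 4-cycles.\<close>
    then obtain \<pi> where \<pi>: "\<pi> permutes S" "map \<pi> [a, b, c, d, e] = [b, c, d, e, a]"
      using permutes_map_lists[of "[a, b, c, d, e]" "[b, c, d, e, a]" S] dist inS e by auto
    define q where "q = \<pi> \<circ> p \<circ> inv' \<pi>"
    note cj = conj[OF \<pi>(1), folded q_def]
    have "q a = a" "q b = c" "q d = e"
      using cj[of e] cj[of a] cj[of c] \<pi>(2) pv pe by auto
    then have "((p \<circ> q) ^^ 2) a = d" "((p \<circ> q) ^^ 3) a = e"
      using pv pe by (simp_all add: numeral_2_eq_2 numeral_3_eq_3)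
    then show False using order[OF \<pi>(1) q_def] dist \<open>e \<notin> {a, b, c, d}\<close> by auto
  qed
  moreover have "card S = 6"
  proof (rule ccontr)
    assume n6: "card S \<noteq> 6"
    show False
    proof (cases "S = {a, b, c, d}")
      case True
      \<comment> \<open>A square cannot be the image of an odd permutation.\<close>
      obtain v where v: "v permutes S" "map v [a, b, c, d] = [c, d, b, a]"
        using permutes_map_lists[of "[a, b, c, d]" "[c, d, b, a]" S] dist inS by auto
      \<comment> \<open>\<open>v\<close> is the 4-cycle (a c b d), and \<open>p\<close> is (a b)(c
        d).\<close>
      have "(v \<circ> v) x = p x" for x
      proof (cases "x \<in> S")
        case True
        then show ?thesis using v(2) pv \<open>S = {a, b, c, d}\<close> by auto
      next
        case False
        then show ?thesis using v(1) pS by (simp add: permutes_def)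
      qed
      then have "v \<circ> v = p" by auto
      obtain w where w: "w permutes S" "\<alpha> w = v" using surjE[OF v(1)] .
      have "\<alpha> (w \<circ> w) = \<alpha> s" using hom[OF w(1) w(1)] w(2) \<open>v \<circ> v = p\<close> p_def by simp
      then have "w \<circ> w = s" using eq_iff[OF permutes_compose[OF w(1) w(1)] sS] by simp
      moreover have "permutation w" using w(1) finite_S by (auto simp: permutation_permutes)
      ultimately have "evenperm s" using evenperm_comp by metis
      then show False using s by (auto simp: is_swap_def evenperm_swap)
    next
      case False
      then obtain e where e: "e \<in> S" "e \<notin> {a, b, c, d}" using inS by auto
      define f where "f = p e"
      have pe: "p e = f" "p f = e" by (simp_all add: f_def)
      have fS: "f \<in> S" using e pin by (simp add: f_def)
      have f: "f \<notin> {a, b, c, d, e}" using e fpf[of e] pv pe by auto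
      have d6: "distinct [a, b, c, d, e, f]" using dist e f by auto
      have "card {a, b, c, d, e, f} = 6" using d6 by simp
      then have "S \<noteq> {a, b, c, d, e, f}" using n6 by auto
      then obtain g where g: "g \<in> S" "g \<notin> {a, b, c, d, e, f}" using inS e fS by auto
      define h where "h = p g"
      have pg: "p g = h" "p h = g" by (simp_all add: h_def)
      have hS: "h \<in> S" using g pin by (simp add: h_def)
      have h: "h \<notin> {a, b, c, d, e, f, g}" using g fpf[of g] pv pe pg by auto
      have d8: "distinct [a, b, c, d, e, f, g, h]" using d6 g h by auto
      then obtain \<pi> where \<pi>: "\<pi> permutes S"
        "map \<pi> [a, b, c, d, e, f, g, h] = [b, c, d, e, f, g, h, a]"
        using permutes_map_lists[of "[a, b, c, d, e, f, g, h]" "[b, c, d, e, f, g, h, a]" S]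
          inS e fS g hS by auto
      define q where "q = \<pi> \<circ> p \<circ> inv' \<pi>"
      note cj = conj[OF \<pi>(1), folded q_def]
      have "q a = h" "q g = f" "q e = d"
        using cj[of h] cj[of f] cj[of d] \<pi>(2) pv pe pg by auto
      then have "((p \<circ> q) ^^ 2) a = e" "((p \<circ> q) ^^ 3) a = c"
        using pv pe pg by (simp_all add: numeral_2_eq_2 numeral_3_eq_3)
      then show False using order[OF \<pi>(1) q_def] d8 by auto
    qed
  qed
  ultimately show ?thesis by (simp add: p_def)
qed

section \<open>Automorphisms preserving transpositions\<close>

text \<open>Distinct transpositions through a fixed point \<open>r\<close> do not commute, hence
  neither do their images, and these turn out to share a common point \<open>a\<close>. The other
  endpoints of the images define \<open>\<sigma>\<close>.\<close>

lemma inner_if_swap_preserving: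
  assumes sw: "\<And>s. is_swap S s \<Longrightarrow> is_swap S (\<alpha> s)" and "card S \<ge> 3"
  shows "\<exists>\<sigma>. inner_on S \<sigma> \<alpha>"
proof -
  obtain xs where xs: "set xs = S" "distinct xs" using finite_distinct_list[OF finite_S] by auto
  then have "length xs \<ge> 3" using assms(2) distinct_card by fastforce
  then obtain r x y xs' where "xs = r # x # y # xs'"
    by (metis Suc_le_length_iff numeral_3_eq_3)
  then have rxy: "r \<in> S" "x \<in> S" "y \<in> S" "distinct [r, x, y]" using xs by auto
  have tS: "u \<in> S \<Longrightarrow> v \<in> S \<Longrightarrow> swp u v permutes S" for u v by (rule permutes_swap_id)
  have nc: "\<alpha> (swp r u) \<circ> \<alpha> (swp r v) \<noteq> \<alpha> (swp r v) \<circ> \<alpha> (swp r u)"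
    if "u \<in> S" "v \<in> S" "distinct [r, u, v]" for u v
  proof -
    have "(swp r u \<circ> swp r v) r \<noteq> (swp r v \<circ> swp r u) r" using that by (auto simp: transpose_def)
    then have "\<alpha> (swp r u \<circ> swp r v) \<noteq> \<alpha> (swp r v \<circ> swp r u)"
      using eq_iff permutes_compose tS rxy(1) that by metis
    then show ?thesis using hom tS rxy(1) that by simp
  qed
  \<comment> \<open>The first two images determine the common point \<open>a\<close>.\<close>
  obtain a b c where abc: "a \<in> S" "b \<in> S" "c \<in> S" "distinct [a, b, c]"
    "\<alpha> (swp r x) = swp a b" "\<alpha> (swp r y) = swp a c"
  proof -
    obtain u v u' v' where uv: "u \<in> S" "v \<in> S" "\<alpha> (swp r x) = swp u v"
      "u' \<in> S" "v' \<in> S" "\<alpha> (swp r y) = swp u' v'"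
      using sw[OF is_swapI[of r S x]] sw[OF is_swapI[of r S y]] rxy by (auto simp: is_swap_def)
    then show ?thesis
      using noncommuting_transposes_share_point[of u v u' v'] nc[of x y] rxy that by fastforce
  qed
  have "\<exists>w\<in>S. w \<noteq> a \<and> \<alpha> (swp r z) = swp a w" if z: "z \<in> S" "z \<noteq> r" for z
  proof (cases "z \<in> {x, y}")
    case True
    then show ?thesis using abc by fastforce
  next
    case False
    obtain u v where uv: "u \<in> S" "v \<in> S" "u \<noteq> v" "\<alpha> (swp r z) = swp u v"
      using sw[OF is_swapI[of r S z]] rxy z by (auto simp: is_swap_def)
    have n1: "swp u v \<circ> swp a b \<noteq> swp a b \<circ> swp u v"
      using nc[of z x] False z rxy uv abc by auto
    have n2: "swp u v \<circ> swp a c \<noteq> swp a c \<circ> swp u v"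
      using nc[of z y] False z rxy uv abc by auto
    \<comment> \<open>A transposition meeting both (a b) and (a c) but avoiding \<open>a\<close> is
      (b c), which is already the image of (x y).\<close>
    have "swp r x \<circ> swp r y \<circ> swp r x = swp x y"
      using rxy by (auto simp: fun_eq_iff transpose_def)
    then have "\<alpha> (swp x y) = swp a b \<circ> swp a c \<circ> swp a b"
      using hom tS rxy abc permutes_compose by metis
    also have "\<dots> = swp b c" using abc by (auto simp: fun_eq_iff transpose_def)
    finally have bc: "\<alpha> (swp x y) = swp b c" .
    have "swp r z r \<noteq> swp x y r" using z rxy by (auto simp: transpose_def)
    then have "swp u v \<noteq> swp b c" using bc uv(4) eq_iff tS rxy z by metis
    have "a = u \<or> a = v"
    proof (rule ccontr)
      assume na: "\<not> (a = u \<or> a = v)"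
      have "b \<in> {u, v}" using n1 na by (auto simp: fun_eq_iff transpose_def split: if_splits)
      moreover have "c \<in> {u, v}" using n2 na by (auto simp: fun_eq_iff transpose_def split: if_splits)
      ultimately show False using \<open>swp u v \<noteq> swp b c\<close> abc(4) by (auto simp: transpose_commute)
    qed
    then show ?thesis using uv by (auto simp: transpose_commute)
  qed
  then obtain \<sigma>' where \<sigma>': "\<And>z. z \<in> S \<Longrightarrow> z \<noteq> r \<Longrightarrow> \<sigma>' z \<in> S \<and> \<sigma>' z \<noteq> a \<and> \<alpha> (swp r z) = swp a (\<sigma>' z)"
    by metis
  \<comment> \<open>The identity off \<open>S\<close>, as \<open>permutes\<close> demands; the
    centre \<open>r\<close> goes to the centre \<open>a\<close>.\<close>
  define \<sigma> where "\<sigma> = (\<lambda>z. if z \<in> S then if z = r then a else \<sigma>' z else z)"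
  have \<sigma>r: "\<sigma> r = a" using rxy by (simp add: \<sigma>_def)
  \<comment> \<open>This includes \<open>z = r\<close>, where both transpositions degenerate to the
    identity.\<close>
  have \<sigma>z: "\<alpha> (swp r z) = swp (\<sigma> r) (\<sigma> z)" if "z \<in> S" for z
    using that \<sigma>'[of z] \<sigma>r image_id by (cases "z = r") (auto simp: \<sigma>_def id_def)
  have "inj_on \<sigma> S"
  proof (rule inj_onI)
    fix u v assume uv: "u \<in> S" "v \<in> S" "\<sigma> u = \<sigma> v"
    then have "swp r u = swp r v" using \<sigma>z eq_iff tS rxy(1) by metis
    then show "u = v" by (metis transpose_apply_first)
  qed
  moreover have "\<sigma> ` S \<subseteq> S" using \<sigma>' abc(1) by (auto simp: \<sigma>_def)
  ultimately have "bij_betw \<sigma> S S" using endo_inj_surj[OF finite_S] by (auto simp: bij_betw_def)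
  then have \<sigma>S: "\<sigma> permutes S" by (rule bij_imp_permutes) (simp add: \<sigma>_def)
  then have inj\<sigma>: "inj \<sigma>" by (rule permutes_inj)
  have swaps: "\<alpha> (swp u v) = swp (\<sigma> u) (\<sigma> v)" if uv: "u \<in> S" "v \<in> S" "u \<noteq> v" for u v
  proof (cases "u = r \<or> v = r")
    case True
    then show ?thesis using \<sigma>z[OF uv(1)] \<sigma>z[OF uv(2)] by (metis transpose_commute)
  next
    case False
    \<comment> \<open>Conjugation reduces an arbitrary transposition to those through
      \<open>r\<close>.\<close>
    have "swp u v = swp r u \<circ> swp r v \<circ> swp r u" using False uv(3)
      by (auto simp: fun_eq_iff transpose_def)
    then have "\<alpha> (swp u v) = swp (\<sigma> r) (\<sigma> u) \<circ> swp (\<sigma> r) (\<sigma> v) \<circ> swp (\<sigma> r) (\<sigma> u)"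
      using hom \<sigma>z tS rxy uv permutes_compose by metis
    also have "\<dots> = swp (\<sigma> u) (\<sigma> v)" using False uv(3)
      by (auto simp: fun_eq_iff transpose_def inj_eq[OF inj\<sigma>])
    finally show ?thesis .
  qed
  \<comment> \<open>Transpositions generate the group, so agreement with conjugation extends from
    them to every permutation.\<close>
  have "\<alpha> p \<circ> \<sigma> = \<sigma> \<circ> p" if "p permutes S" for p
    using that finite_S
  proof (induction rule: permutes_induct)
    case id
    show ?case by (simp only: image_id id_comp comp_id)
  next
    case (swap u v p)
    have "\<alpha> (swp u v \<circ> p) \<circ> \<sigma> = swp (\<sigma> u) (\<sigma> v) \<circ> (\<alpha> p \<circ> \<sigma>)"
      using hom[OF tS[OF swap.hyps(1,2)]] swaps swap by (simp add: comp_assoc)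
    also have "\<alpha> p \<circ> \<sigma> = \<sigma> \<circ> p" by (rule swap.IH)
    also have "swp (\<sigma> u) (\<sigma> v) \<circ> (\<sigma> \<circ> p) = (\<sigma> \<circ> swp u v) \<circ> p"
      by (simp only: inj_comp_transpose[OF inj\<sigma>] comp_assoc)
    finally show ?case by (simp only: comp_assoc)
  qed
  then show ?thesis using \<sigma>S permutes_image unfolding inner_on_def by blast
qed

section \<open>Exceptional automorphisms in degree 6\<close>

lemma outer_regular_point:
  assumes s0: "is_swap S s0" and ns0: "\<not> is_swap S (\<alpha> s0)"
  shows "\<exists>g. g permutes S \<and>
    (\<forall>j. (\<alpha> ^^ j) g = g \<longrightarrow> (\<forall>p. p permutes S \<longrightarrow> (\<alpha> ^^ j) p = p))"
proof -
  interpret sq: symmetric_auto S "\<alpha> \<circ> \<alpha>" by (rule symmetric_auto_comp)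
  have ns: "\<not> is_swap S (\<alpha> s)" if "is_swap S s" for s
    using is_swap_image_all[OF that _ s0] ns0 by blast
  have card6: "card S = 6" using swap_image_exceptional[OF s0 ns0] by simp
  \<comment> \<open>Otherwise \<open>\<alpha> s\<close> and \<open>\<alpha> (\<alpha> s)\<close>
    would both be fixed-point-free involutions, hence conjugate; pulling the conjugation back along
    \<open>\<alpha>\<close> would make \<open>s\<close> conjugate to \<open>\<alpha> s\<close>,
    which is no transposition.\<close>
  have sw2: "is_swap S ((\<alpha> \<circ> \<alpha>) s)" if s: "is_swap S s" for s
  proof (rule ccontr)
    assume n: "\<not> is_swap S ((\<alpha> \<circ> \<alpha>) s)"
    have sS: "s permutes S" using s by (rule is_swap_permutes)
    note \<alpha>S = permutes_image[OF sS]
    have ss: "s \<circ> s = id" using s by (auto simp: is_swap_def)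
    have inv1: "\<alpha> s \<circ> \<alpha> s = id" using hom[OF sS sS] ss image_id by simp
    have inv2: "\<alpha> (\<alpha> s) \<circ> \<alpha> (\<alpha> s) = id" using hom[OF \<alpha>S \<alpha>S] inv1 image_id by simp
    obtain \<pi> where \<pi>: "\<pi> permutes S" "\<pi> \<circ> \<alpha> s = \<alpha> (\<alpha> s) \<circ> \<pi>"
      using fixed_point_free_involutions_conjugate[OF \<alpha>S inv1 _ permutes_image[OF \<alpha>S] inv2 _ card6]
        swap_image_exceptional[OF s ns[OF s]] sq.swap_image_exceptional[OF s n] by auto
    obtain u where u: "u permutes S" "\<alpha> u = \<pi>" using surjE[OF \<pi>(1)] .
    have "\<alpha> (u \<circ> s) = \<alpha> (\<alpha> s \<circ> u)" using \<pi>(2) u hom sS \<alpha>S by simp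
    then have "u \<circ> s = \<alpha> s \<circ> u"
      using eq_iff[OF permutes_compose[OF sS u(1)] permutes_compose[OF u(1) \<alpha>S]] by simp
    then have "u \<circ> s \<circ> inv' u = \<alpha> s"
      using permutes_inv_o(1)[OF u(1)] by (simp add: comp_assoc)
    then show False using is_swap_conj[OF s u(1)] ns[OF s] by simp
  qed
  obtain \<sigma> where inner: "inner_on S \<sigma> (\<alpha> \<circ> \<alpha>)"
    using sq.inner_if_swap_preserving[OF sw2] card6 by auto
  then have \<sigma>: "\<sigma> permutes S" by (simp add: inner_on_def)
  have inj\<sigma>: "inj \<sigma>" using \<sigma> by (rule permutes_inj)
  have "\<alpha> ^^ 2 = \<alpha> \<circ> \<alpha>" by (simp add: numeral_2_eq_2)
  then have pow2: "\<alpha> ^^ (2 * i) = (\<alpha> \<circ> \<alpha>) ^^ i" for i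
    by (metis funpow_mult mult.commute)
  have swap_pow: "is_swap S (((\<alpha> \<circ> \<alpha>) ^^ i) s)" if "is_swap S s" for i s
    using that sw2 by (induction i) simp_all
  \<comment> \<open>An odd power is \<open>\<alpha>\<close> after a power of
    \<open>\<alpha> \<circ> \<alpha>\<close>, so it sends transpositions to
    non-transpositions.\<close>
  have even: "even j" if s: "is_swap S s" and fixed: "(\<alpha> ^^ j) s = s" for s j
  proof (rule ccontr)
    assume "odd j"
    then obtain i where "j = Suc (2 * i)" by (auto elim: oddE)
    then have "(\<alpha> ^^ j) s = \<alpha> (((\<alpha> \<circ> \<alpha>) ^^ i) s)" using pow2[of i] by simp
    then show False using ns[OF swap_pow[OF s, of i]] fixed s by simp
  qed
  \<comment> \<open>A power of \<open>\<alpha>\<close> fixing \<open>g\<close> also fixes the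
    transposition \<open>g ^^ k\<close>, so its exponent is even. It is then conjugation by a power
    of \<open>\<sigma>\<close>, which \<open>cent\<close> shows to be trivial.\<close>
  have reduce: ?thesis
    if g: "g permutes S" "is_swap S (g ^^ k)"
      and cent: "\<And>i x. (\<And>y. g ((\<sigma> ^^ i) y) = (\<sigma> ^^ i) (g y)) \<Longrightarrow> x \<in> S \<Longrightarrow> (\<sigma> ^^ i) x = x"
    for g k
  proof (intro exI[of _ g] conjI allI impI)
    fix j p assume j: "(\<alpha> ^^ j) g = g" and p: "p permutes S"
    have "even j" using even[OF g(2)] funpow_image_funpow[OF g(1)] j by simp
    then obtain i where i: "j = 2 * i" by (auto elim: evenE)
    have "(\<sigma> ^^ i) x = x" if "x \<in> S" for x
      using cent[OF inner_on_funpow_fixed[OF inner g(1)]] that j pow2[of i] i by simp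
    then show "(\<alpha> ^^ j) p = p" using inner_on_funpow_id[OF inner p] pow2[of i] i by simp
  qed (rule g(1))
  consider "\<sigma> = id" | x where "\<sigma> x \<noteq> x" "\<And>y. \<sigma> (\<sigma> y) = y" | x where "\<sigma> (\<sigma> x) \<noteq> x"
    by (auto simp: fun_eq_iff)
  then show ?thesis
  proof cases
    case 1
    show ?thesis by (rule reduce[of s0 1]) (use s0 1 is_swap_permutes[OF s0] in simp_all)
  next
    case (2 x)
    have xS: "x \<in> S" using 2(1) \<sigma> by (auto simp: permutes_def)
    have "card {x, \<sigma> x} \<le> 2" by (simp add: card_insert_if)
    then have "S \<noteq> {x, \<sigma> x}" using card6 by auto
    \<comment> \<open>With \<open>b\<close> outside \<open>{x, \<sigma> x}\<close>, the support
      \<open>{x, b}\<close> is not preserved by \<open>\<sigma>\<close>, so \<open>\<sigma>\<close>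
      does not commute with the transposition.\<close>
    then obtain b where b: "b \<in> S" "b \<noteq> x" "b \<noteq> \<sigma> x"
      using xS permutes_in_image[OF \<sigma>, of x] by blast
    show ?thesis
    proof (rule reduce[of "swp x b" 1])
      show "swp x b permutes S" using xS b(1) by (rule permutes_swap_id)
      show "is_swap S (swp x b ^^ 1)" using is_swapI[OF xS b(1)] b(2) by auto
      fix i y
      assume comm: "\<And>y. swp x b ((\<sigma> ^^ i) y) = (\<sigma> ^^ i) (swp x b y)"
      have "\<sigma> ^^ 2 = id" using 2(2) by (simp add: fun_eq_iff numeral_2_eq_2)
      then have ev: "\<sigma> ^^ (2 * m) = id" for m by (metis funpow_mult id_funpow mult.commute)
      have "even i"
      proof (rule ccontr)
        assume "odd i"
        then obtain m where "i = Suc (2 * m)" by (auto elim: oddE)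
        then have "\<sigma> ^^ i = \<sigma>" using ev[of m] by simp
        then have "swp x b (\<sigma> x) = \<sigma> b" using comm[of x] by simp
        moreover have "swp x b (\<sigma> x) = \<sigma> x" using 2(1) b(3) by (intro transpose_apply_other) auto
        ultimately show False using inj\<sigma> b(2) by (metis injD)
      qed
      then show "(\<sigma> ^^ i) y = y" using ev by (auto elim: evenE)
    qed
  next
    case (3 x)
    define y where "y = \<sigma> x"
    define z where "z = \<sigma> y"
    have "\<sigma> x \<noteq> x" using 3 by auto
    then have xyz: "distinct [x, y, z]" using 3 inj\<sigma> by (auto simp: y_def z_def inj_eq)
    have "x \<in> S" using \<open>\<sigma> x \<noteq> x\<close> \<sigma> by (auto simp: permutes_def)
    then have xyzS: "{x, y, z} \<subseteq> S" using permutes_in_image[OF \<sigma>] by (simp add: y_def z_def)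
    have "card {x, y, z} = 3" using xyz by simp
    then have "card (S - {x, y, z}) = 3" using card6 xyzS by (subst card_Diff_subset) auto
    then obtain b c e where bce: "S - {x, y, z} = {b, c, e}" "b \<noteq> c" "b \<noteq> e" "c \<noteq> e"
      by (auto simp: card_3_iff)
    have S: "S = {x, y, z, b, c, e}" using bce(1) xyzS by blast
    have dist: "distinct [y, b, c, z, e]" "x \<notin> {y, b, c, z, e}" using bce xyz by auto
    have subs: "set [y, b, c, z, e] \<subseteq> S - {x}" "set [b, c, y, e, z] \<subseteq> S - {x}"
      using S dist by auto
    \<comment> \<open>\<open>g\<close> is (y b c)(z e), with \<open>x\<close> as its only fixed
      point in \<open>S\<close> and cube (z e). A power of \<open>\<sigma>\<close> commuting with
      \<open>g\<close> fixes \<open>x\<close>, hence also \<open>y = \<sigma> x\<close> and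
      \<open>z = \<sigma> y\<close>, which lie on different cycles of \<open>g\<close>, and so both
      cycles.\<close>
    obtain g where g: "g permutes S - {x}" "map g [y, b, c, z, e] = [b, c, y, e, z]"
      using permutes_map_lists[OF dist(1) _ _ subs] dist(1) by auto
    have gv: "g x = x" "g y = b" "g b = c" "g c = y" "g z = e" "g e = z"
      using g by (auto simp: permutes_def)
    have gS: "g permutes S" using g(1) by (rule permutes_subset) auto
    have g3: "(g ^^ 3) u = swp z e u" for u
    proof (cases "u \<in> S")
      case True
      then have "u \<in> {x, y, z, b, c, e}" using S by simp
      then show ?thesis using gv dist by (auto simp: numeral_3_eq_3 transpose_def)
    next
      case False
      then show ?thesis using permutes_not_in[OF gS False] S
        by (simp add: numeral_3_eq_3 transpose_def)
    qed
    show ?thesis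
    proof (rule reduce[of g 3])
      show "g permutes S" by (rule gS)
      have "g ^^ 3 = swp z e" using g3 by (rule ext)
      then show "is_swap S (g ^^ 3)" using S dist by (auto intro!: is_swapI)
      fix i u
      assume comm: "\<And>w. g ((\<sigma> ^^ i) w) = (\<sigma> ^^ i) (g w)" and u: "u \<in> S"
      let ?\<tau> = "\<sigma> ^^ i"
      have "?\<tau> x \<in> S" using permutes_in_image[OF permutes_funpow[OF \<sigma>]] \<open>x \<in> S\<close> by simp
      then have "?\<tau> x \<in> {x, y, z, b, c, e}" using S by simp
      moreover have "g (?\<tau> x) = ?\<tau> x" using comm[of x] gv(1) by simp
      ultimately have \<tau>x: "?\<tau> x = x" using gv dist by auto
      have step: "?\<tau> (\<sigma> w) = \<sigma> w" "?\<tau> (g w) = g w" if "?\<tau> w = w" for w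
        using comm[of w] that funpow_swap1[of \<sigma> i w] by metis+
      have \<tau>y: "?\<tau> y = y" using step(1)[OF \<tau>x] by (simp add: y_def)
      have \<tau>z: "?\<tau> z = z" using step(1)[OF \<tau>y] by (simp add: z_def)
      have \<tau>e: "?\<tau> e = e" using step(2)[OF \<tau>z] gv by simp
      have \<tau>b: "?\<tau> b = b" using step(2)[OF \<tau>y] gv by simp
      have \<tau>c: "?\<tau> c = c" using step(2)[OF \<tau>b] gv by simp
      show "?\<tau> u = u" using u S \<tau>x \<tau>y \<tau>z \<tau>b \<tau>c \<tau>e by auto
    qed
  qed
qed

section \<open>Small degrees and the case distinction\<close>

text \<open>\<open>id\<close>, \<open>p\<close> and \<open>\<alpha> p\<close> would otherwise be
  three distinct elements of a group of order at most 2.\<close>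

lemma image_card_le_2:
  assumes "card S \<le> 2" "p permutes S"
  shows "\<alpha> p = p"
proof (rule ccontr)
  assume neq: "\<alpha> p \<noteq> p"
  then have "p \<noteq> id" using image_id by auto
  then have "\<alpha> p \<noteq> id" using eq_iff[OF assms(2) permutes_id] image_id by simp
  then have "card {id, p, \<alpha> p} = 3" using neq \<open>p \<noteq> id\<close> by auto
  moreover have "{id, p, \<alpha> p} \<subseteq> {p. p permutes S}"
    using assms(2) permutes_image[OF assms(2)] permutes_id[of S] by blast
  then have "card {id, p, \<alpha> p} \<le> card {p. p permutes S}"
    by (rule card_mono[OF finite_permutations[OF finite_S]])
  ultimately have "3 \<le> (fact (card S) :: nat)"
    using card_permutations[OF refl finite_S] by simp
  moreover have "(fact (card S) :: nat) \<le> fact 2" using assms(1) by (rule fact_mono_nat)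
  ultimately show False by (simp add: fact_numeral)
qed

lemma regular_point:
  "\<exists>g. g permutes S \<and>
    (\<forall>j. (\<alpha> ^^ j) g = g \<longrightarrow> (\<forall>p. p permutes S \<longrightarrow> (\<alpha> ^^ j) p = p))"
proof -
  consider "card S \<le> 2" | "card S \<ge> 3" "\<And>s. is_swap S s \<Longrightarrow> is_swap S (\<alpha> s)"
    | s where "is_swap S s" "\<not> is_swap S (\<alpha> s)"
    by (metis not_less_eq_eq numeral_2_eq_2 numeral_3_eq_3)
  then show ?thesis
  proof cases
    case 1
    have "(\<alpha> ^^ j) p = p" if "p permutes S" for j p
      using image_card_le_2[OF 1 that] by (induction j) simp_all
    with permutes_id[of S] show ?thesis by metis
  next
    case 2
    obtain \<sigma> where "inner_on S \<sigma> \<alpha>" using inner_if_swap_preserving 2 by blast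
    then show ?thesis using inner_regular_point[OF finite_S _ 2(1)] by metis
  next
    case 3
    then show ?thesis by (rule outer_regular_point)
  qed
qed

end

section \<open>From regular points to regular cycles\<close>

text \<open>Elements of \<open>Bij X\<close> are extensional, hence \<open>undefined\<close> off
  \<open>X\<close>, while \<open>f ^^ 0\<close> is the identity everywhere; restriction reconciles
  the two.\<close>

lemma BijGroup_pow:
  assumes f: "f \<in> Bij X"
  shows "f [^]\<^bsub>BijGroup X\<^esub> (j :: nat) = restrict (f ^^ j) X"
proof -
  interpret group "BijGroup X" by (rule group_BijGroup)
  have mult: "g \<otimes>\<^bsub>BijGroup X\<^esub> f = compose X g f" if "g \<in> carrier (BijGroup X)" for g
    using that f by (simp add: BijGroup_def)
  have fc: "f \<in> carrier (BijGroup X)" using f by (simp add: BijGroup_def)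
  show ?thesis
  proof (induction j)
    case 0
    have "f [^]\<^bsub>BijGroup X\<^esub> (0 :: nat) = \<one>\<^bsub>BijGroup X\<^esub>" by (rule nat_pow_0)
    also have "\<dots> = restrict (f ^^ 0) X" by (simp add: BijGroup_def id_def)
    finally show ?case .
  next
    case (Suc j)
    have "f [^]\<^bsub>BijGroup X\<^esub> Suc j = compose X (f [^]\<^bsub>BijGroup X\<^esub> j) f"
      using mult[OF nat_pow_closed[OF fc]] by (simp only: nat_pow_Suc)
    also have "\<dots> = compose X (restrict (f ^^ j) X) f" by (simp only: Suc)
    also have "\<dots> = restrict (f ^^ Suc j) X"
    proof (rule ext)
      fix x
      have "f x \<in> X" if "x \<in> X" using that Bij_imp_funcset[OF f] by auto
      then show "compose X (restrict (f ^^ j) X) f x = restrict (f ^^ Suc j) X x"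
        by (auto simp: compose_def funpow_swap1)
    qed
    finally show ?case .
  qed
qed

text \<open>A power fixing \<open>x\<close> is trivial on \<open>X\<close>, so \<open>x\<close>
  first returns after exactly \<open>ord f\<close> steps.\<close>

lemma perm_RCC_if_regular_point:
  assumes X: "finite X" and f: "f \<in> Bij X" and x: "x \<in> X"
    and reg: "\<And>j y. (f ^^ j) x = x \<Longrightarrow> y \<in> X \<Longrightarrow> (f ^^ j) y = y"
  shows "perm_RCC X f"
proof -
  interpret group "BijGroup X" by (rule group_BijGroup)
  have fc: "f \<in> carrier (BijGroup X)" using f by (simp add: BijGroup_def)
  \<comment> \<open>Finiteness of the group makes \<open>ord f\<close> positive; \<open>ord\<close>
    is 0 for elements of infinite order.\<close>
  have "Bij X \<subseteq> X \<rightarrow>\<^sub>E X" using Bij_imp_funcset Bij_imp_extensional by (auto simp: PiE_def)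
  then have "finite (carrier (BijGroup X))"
    using finite_PiE[OF X X] finite_subset by (auto simp: BijGroup_def)
  then have o1: "ord f \<ge> 1" using fc by (rule ord_ge_1)
  have pow_one: "f [^]\<^bsub>BijGroup X\<^esub> j = \<one>\<^bsub>BijGroup X\<^esub> \<longleftrightarrow> (\<forall>y\<in>X. (f ^^ j) y = y)" for j :: nat
    unfolding BijGroup_pow[OF f] by (auto simp: BijGroup_def restrict_def fun_eq_iff)
  have fix_iff: "(f ^^ j) x = x \<longleftrightarrow> ord f dvd j" for j
    using pow_one[of j] pow_eq_id[OF fc, of j] reg[of j] x by blast
  have bij: "bij_betw f X X" using f by (simp add: Bij_def)
  have inj: "inj_on (f ^^ k) X" and img: "(f ^^ k) x \<in> X" for k
    using bij_betw_funpow[OF bij, of k] x by (auto simp: bij_betw_def)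
  have "inj_on (\<lambda>m. (f ^^ m) x) {..<ord f}"
  proof (rule linorder_inj_onI)
    fix a b assume ab: "a < b" "a \<in> {..<ord f}" "b \<in> {..<ord f}"
    show "(f ^^ a) x \<noteq> (f ^^ b) x"
    proof
      assume "(f ^^ a) x = (f ^^ b) x"
      also have "(f ^^ b) x = (f ^^ a) ((f ^^ (b - a)) x)"
        using ab(1) funpow_add[of a "b - a" f] by simp
      finally have "(f ^^ (b - a)) x = x"
        using inj_onD[OF inj[of a]] x img by metis
      then have "ord f dvd b - a" using fix_iff by simp
      then show False using ab by (auto dest: dvd_imp_le)
    qed
  qed auto
  \<comment> \<open>\<open>orbit\<close> starts at \<open>f x\<close>; since \<open>x\<close>
    returns after \<open>ord f \<ge> 1\<close> steps, it is also the set of the first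
    \<open>ord f\<close> iterates counted from \<open>x\<close> itself.\<close>
  moreover have "orbit f x = (\<lambda>m. (f ^^ m) x) ` {..<ord f}"
    using orbit_altdef_bounded[of "ord f" f x] fix_iff[of "ord f"] o1 by auto
  ultimately have "card (orbit f x) = ord f" by (simp add: card_image)
  then show ?thesis using X f x by (auto simp: perm_RCC_def)
qed

theorem proposition5p2:
  fixes n :: nat
  shows "group_RCC (sym_group n)"
  unfolding group_RCC_def
proof (intro conjI ballI)
  show "group (sym_group n)" by (rule sym_group_is_group)
  show fin: "finite (carrier (sym_group n))"
    by (simp add: sym_group_def finite_permutations)
  fix \<alpha> assume \<alpha>: "\<alpha> \<in> auto (sym_group n)"
  then have B: "\<alpha> \<in> Bij (carrier (sym_group n))" by (simp add: auto_def)
  \<comment> \<open>For \<open>n = 0\<close> the underlying set is empty, which falls under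
    \<open>card S \<le> 2\<close>.\<close>
  interpret symmetric_auto "{1..n}" \<alpha>
    using \<alpha> by unfold_locales (auto simp: auto_def Bij_def hom_def sym_group_def)
  obtain g where "g permutes {1..n}"
    "\<And>j p. (\<alpha> ^^ j) g = g \<Longrightarrow> p permutes {1..n} \<Longrightarrow> (\<alpha> ^^ j) p = p"
    using regular_point by blast
  then show "perm_RCC (carrier (sym_group n)) \<alpha>"
    by (intro perm_RCC_if_regular_point[OF fin B]) (auto simp: sym_group_carrier)
qed

end
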